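(* Let $k\ge 3$. Consider a stochastic PPSWOR sample over a finite key set $\mathcal X$ with random weights $S_x=\sum_{i=1}^{r_x}S_{x,i}$, where the $S_{x,i}$ are independent random variables with values in $[0,T]$, $T>0$. Let $v_x=\mathsf E[S_x]$ and $V=\sum_{x\in\mathcal X}v_x$. If $V\ge Tk$, then for every key $x\in\mathcal X$ the bottom-$k$ inverse-probability estimator $\widehat{v_x}$ of $v_x$ satisfies $$\mathsf{Var}\left[\widehat{v_x}\right]\le\frac{4v_xV}{k-2}.$$
   Context: Each key $x\in\mathcal X$ has $r_x\ge0$ random variables $S_{x,1},\dots,S_{x,r_x}$ with values in $[0,T]$; all of these variables (over all keys and indices) are mutually independent. The weight of $x$ is $S_x=\sum_{i=1}^{r_x}S_{x,i}$. Stochastic PPSWOR sample: first draw the weights $S_x$; then, given the weights, draw independently for each $x$ a value $\mathrm{seed}(x)\sim\mathrm{Exp}(S_x)$ (exponential with rate $S_x$; $\mathrm{seed}(x)=+\infty$ if $S_x=0$). As a bottom-$k$ sample: the inclusion threshold $\tau$ is the $k$-th lowest seed ($+\infty$ if fewer than $k$ seeds are finite), and the sample $S$ is the set of the $k-1$ keys with lowest seeds (all keys with finite seed, if there are fewer than $k-1$ of them). Inverse-probability estimator: let $p_x(t)=\Pr[\mathrm{seed}(x)<t]$, computed from the unconditional distribution of $\mathrm{seed}(x)$ (including the randomness of $S_x$). Then $\widehat{v_x}=v_x/p_x(\tau)$ if $x\in S$, and $\widehat{v_x}=0$ if $x\notin S$. *)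

theory Defs
  imports "HOL-Probability.Probability"
begin

definition weight :: "('x \<Rightarrow> nat) \<Rightarrow> ('x \<Rightarrow> nat \<Rightarrow> 'a \<Rightarrow> real) \<Rightarrow> 'x \<Rightarrow> 'a \<Rightarrow> real" where
  "weight r S x \<omega> = (\<Sum>i\<in>{1..r x}. S x i \<omega>)"

text \<open>Exponential distribution with rate \<open>w\<close> on the extended reals; rate \<open>0\<close> gives the point
  mass at \<open>\<infinity>\<close>. Negative rates do not occur; mapping them to the same point mass makes the kernel total.\<close>

definition seed_dist :: "real \<Rightarrow> ereal measure" where
  "seed_dist w =
     (if w > 0 then distr (density lborel (exponential_density w)) borel ereal
      else return borel \<infinity>)"

text \<open>The joint law of weights and seeds is that of the two-stage experiment: draw the vector of
  weights, then, given the weights, draw the seeds independently from \<open>seed_dist\<close>.\<close>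

definition ppswor_seeds ::
  "'a measure \<Rightarrow> 'x set \<Rightarrow> ('x \<Rightarrow> 'a \<Rightarrow> real) \<Rightarrow> ('x \<Rightarrow> 'a \<Rightarrow> ereal) \<Rightarrow> bool" where
  "ppswor_seeds M X W seed \<longleftrightarrow>
     (\<forall>x\<in>X. W x \<in> borel_measurable M) \<and>
     (\<forall>x\<in>X. seed x \<in> borel_measurable M) \<and>
     distr M (PiM X (\<lambda>_. borel) \<Otimes>\<^sub>M PiM X (\<lambda>_. borel))
       (\<lambda>\<omega>. (\<lambda>x\<in>X. W x \<omega>, \<lambda>x\<in>X. seed x \<omega>)) =
     do {
       w \<leftarrow> distr M (PiM X (\<lambda>_. borel)) (\<lambda>\<omega>. \<lambda>x\<in>X. W x \<omega>);
       s \<leftarrow> PiM X (\<lambda>x. seed_dist (w x));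
       return (PiM X (\<lambda>_. borel) \<Otimes>\<^sub>M PiM X (\<lambda>_. borel)) (w, s)
     }"

text \<open>The \<open>k\<close>-th lowest seed, counted with multiplicity.\<close>

definition threshold :: "nat \<Rightarrow> 'x set \<Rightarrow> ('x \<Rightarrow> ereal) \<Rightarrow> ereal" where
  "threshold k X s =
     (if card {x\<in>X. s x < \<infinity>} < k then \<infinity>
      else sorted_list_of_multiset (image_mset s (mset_set X)) ! (k - 1))"

text \<open>The keys with the \<open>k - 1\<close> lowest seeds, among those with finite seed: fewer than \<open>k - 1\<close>
  keys have a smaller seed. Ties between finite seeds have probability zero.\<close>

definition bottom_sample :: "nat \<Rightarrow> 'x set \<Rightarrow> ('x \<Rightarrow> ereal) \<Rightarrow> 'x set" where
  "bottom_sample k X s = {x\<in>X. s x < \<infinity> \<and> card {y\<in>X. s y < s x} < k - 1}"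

definition inclusion_prob :: "'a measure \<Rightarrow> ('a \<Rightarrow> ereal) \<Rightarrow> ereal \<Rightarrow> real" where
  "inclusion_prob M seed_x t = measure M {\<omega>\<in>space M. seed_x \<omega> < t}"

definition inv_prob_estimator ::
  "'a measure \<Rightarrow> nat \<Rightarrow> 'x set \<Rightarrow> ('x \<Rightarrow> 'a \<Rightarrow> ereal) \<Rightarrow> real \<Rightarrow> 'x \<Rightarrow> 'a \<Rightarrow> real" where
  "inv_prob_estimator M k X seed v x \<omega> =
     (if x \<in> bottom_sample k X (\<lambda>y. seed y \<omega>)
      then v / inclusion_prob M (seed x) (threshold k X (\<lambda>y. seed y \<omega>))
      else 0)"

end

theory Submission
  imports Defs
begin

text \<open>
  Let \<open>Z\<close> be the \<open>(k - 1)\<close>-th lowest seed among the keys other than \<open>x\<close>. It is independent of the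
  seed of \<open>x\<close>; the key \<open>x\<close> is sampled iff its seed is finite and at most \<open>Z\<close>, and then the threshold
  is \<open>Z\<close>. Conditioning on \<open>Z\<close> shows that the variance is the mean of \<open>v\<^sub>x\<^sup>2 (1 / p\<^sub>x(Z) - 1)\<close>.

  Bounding \<open>exp\<close> by its chord on \<open>[0, T]\<close> gives \<open>1 - p\<^sub>x(t) \<le> exp (- v\<^sub>x u)\<close> with
  \<open>u = (1 - exp (- T t)) / T\<close>, hence \<open>v\<^sub>x (1 / p\<^sub>x(t) - 1) \<le> 1 / u \<le> T + 1 / t\<close>, and it remains to bound the
  mean of \<open>1 / Z\<close>. As \<open>p\<^sub>y(t) \<le> v\<^sub>y t\<close>, the second factorial moment of the number of seeds below \<open>t\<close> gives
  \<open>P(Z < t) \<le> (V t)\<^sup>2 / (m (m - 1))\<close> with \<open>m = k - 1\<close>. Integrating this against \<open>1 / t\<^sup>2\<close> up to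
  \<open>a = (m - 1) / V\<close> bounds the mean of \<open>1 / Z\<close> by \<open>2 V / (k - 2)\<close>, while \<open>T \<le> V / k\<close>.
\<close>

subsection \<open>Seeds\<close>

lemma sets_seed_dist [simp, measurable_cong]: "sets (seed_dist w) = sets borel"
  by (simp add: seed_dist_def)

lemma space_seed_dist [simp]: "space (seed_dist w) = UNIV"
  by (simp add: seed_dist_def)

lemma prob_space_seed_dist: "prob_space (seed_dist w)"
proof (cases "w > 0")
  case True
  interpret prob_space "density lborel (exponential_density w)"
    using True by (rule prob_space_exponential_density)
  show ?thesis using True by (simp add: seed_dist_def prob_space_distr)
qed (simp add: seed_dist_def prob_space_return)

text \<open>Both cases become one expression in \<open>w\<close>, from which measurability in the
  rate and the absence of finite atoms can be read off.\<close>

lemma emeasure_seed_dist: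
  assumes [measurable]: "A \<in> sets borel"
  shows "emeasure (seed_dist w) A =
    (if w > 0 then \<integral>\<^sup>+z. ennreal (exponential_density w z) * indicator A (ereal z) \<partial>lborel
     else indicator A \<infinity>)"
proof -
  have "emeasure (distr (density lborel (exponential_density w)) borel ereal) A
    = (\<integral>\<^sup>+z. ennreal (exponential_density w z) * indicator (ereal -` A) z \<partial>lborel)"
    using measurable_sets_borel[of ereal borel A] by (subst emeasure_distr) (auto simp: emeasure_density)
  then show ?thesis by (simp add: seed_dist_def indicator_vimage)
qed

lemma measurable_emeasure_seed_dist:
  assumes [measurable]: "A \<in> sets borel"
  shows "(\<lambda>w. emeasure (seed_dist w) A) \<in> borel_measurable borel"
  unfolding emeasure_seed_dist[OF assms] exponential_density_def by measurable

text \<open>Makes the draw of the seeds a kernel, so that the bind in the joint law can be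
  evaluated. Boxes generate the product sigma-algebra and are stable under intersection, and the
  mass of a box is a finite product of functions measurable in \<open>w\<close>.\<close>

lemma measurable_PiM_seed_dist:
  assumes "finite X"
  shows "(\<lambda>w. PiM X (\<lambda>x. seed_dist (w x))) \<in> PiM X (\<lambda>_. borel) \<rightarrow>\<^sub>M prob_algebra (PiM X (\<lambda>_. borel))"
proof (rule measurable_prob_algebra_generated[OF sets_PiM Int_stable_prod_algebra prod_algebra_sets_into_space])
  fix w
  interpret product_prob_space "\<lambda>x. seed_dist (w x)" X
    by (simp add: product_prob_space_def product_prob_space_axioms_def product_sigma_finite_def
        prob_space_seed_dist prob_space_imp_sigma_finite)
  show "prob_space (PiM X (\<lambda>x. seed_dist (w x)))" by (rule prob_space_axioms)
  show "sets (PiM X (\<lambda>x. seed_dist (w x))) = sets (PiM X (\<lambda>_. borel))"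
    by (rule sets_PiM_cong) auto
next
  fix A :: "('a \<Rightarrow> ereal) set" assume "A \<in> prod_algebra X (\<lambda>_. borel)"
  then obtain E where A: "A = Pi\<^sub>E X E" and E: "\<And>x. x \<in> X \<Longrightarrow> E x \<in> sets borel"
    using assms by (auto elim!: prod_algebraE_all)
  have "emeasure (PiM X (\<lambda>x. seed_dist (w x))) A = (\<Prod>x\<in>X. emeasure (seed_dist (w x)) (E x))" for w
  proof -
    interpret product_sigma_finite "\<lambda>x. seed_dist (w x)"
      by (simp add: product_sigma_finite_def prob_space_seed_dist prob_space_imp_sigma_finite)
    show ?thesis unfolding A by (rule emeasure_PiM) (use assms E in auto)
  qed
  then show "(\<lambda>w. emeasure (PiM X (\<lambda>x. seed_dist (w x))) A) \<in> borel_measurable (PiM X (\<lambda>_. borel))"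
    using E by (auto intro!: borel_measurable_prod_ennreal measurable_compose[OF _ measurable_emeasure_seed_dist])
qed

lemma emeasure_seed_dist_less:
  assumes "0 \<le> w" "0 < t"
  shows "emeasure (seed_dist w) {..<ereal t} = ennreal (1 - exp (- w * t))"
proof (cases "w > 0")
  case True
  interpret prob_space "density lborel (exponential_density w)"
    using True by (rule prob_space_exponential_density)
  \<comment> \<open>The known distribution function concerns the closed half-line; the endpoint is a
    null set.\<close>
  have "AE z in lborel. z \<noteq> t" by (rule AE_lborel_singleton)
  then have "emeasure (seed_dist w) {..<ereal t}
    = (\<integral>\<^sup>+z. ennreal (exponential_density w z) * indicator {..t} z \<partial>lborel)"
    using True by (auto simp: emeasure_seed_dist intro!: nn_integral_cong_AE split: split_indicator)
  also have "\<dots> = emeasure (density lborel (exponential_density w)) {..t}"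
    by (simp add: emeasure_density)
  also have "\<dots> = ennreal (1 - exp (- w * t))"
    using emeasure_erlang_density[of w 0 t] True assms by (simp add: erlang_CDF_0)
  finally show ?thesis .
qed (use assms in \<open>simp add: emeasure_seed_dist\<close>)

lemma emeasure_seed_dist_singleton:
  assumes "z \<noteq> \<infinity>"
  shows "emeasure (seed_dist w) {z} = 0"
proof -
  \<comment> \<open>This also covers \<open>z = -\<infinity>\<close>: \<open>real_of_ereal\<close>
    then returns 0, but no \<open>ereal y\<close> equals \<open>z\<close>, so the indicator vanishes
    anyway.\<close>
  have "AE y in lborel. ennreal (exponential_density w y) * indicator {z} (ereal y) = 0"
    using AE_lborel_singleton[of "real_of_ereal z"]
    by (rule eventually_mono) (auto split: split_indicator)
  then have "(\<integral>\<^sup>+y. ennreal (exponential_density w y) * indicator {z} (ereal y) \<partial>lborel) = 0"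
    by (rule nn_integral_zero')
  then show ?thesis using assms by (simp add: emeasure_seed_dist)
qed

text \<open>The joint law is evaluated on a box with free weight coordinates: given the weights the
  seeds are independent, which yields the product, and the outer draw averages it. Every later fact
  about the law of the seeds rests on this formula.\<close>

lemma (in prob_space) emeasure_ppswor_seeds:
  assumes X: "finite X" and P: "ppswor_seeds M X W seed"
    and B: "\<And>x. x \<in> X \<Longrightarrow> B x \<in> sets borel"
  shows "emeasure M {\<omega>\<in>space M. \<forall>x\<in>X. seed x \<omega> \<in> B x}
    = (\<integral>\<^sup>+\<omega>. (\<Prod>x\<in>X. emeasure (seed_dist (W x \<omega>)) (B x)) \<partial>M)"
proof -
  let ?P = "PiM X (\<lambda>_. borel) :: ('b \<Rightarrow> real) measure"
  let ?Q = "PiM X (\<lambda>_. borel) :: ('b \<Rightarrow> ereal) measure"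
  let ?D = "distr M ?P (\<lambda>\<omega>. \<lambda>x\<in>X. W x \<omega>)"
  have W [measurable]: "\<And>x. x \<in> X \<Longrightarrow> W x \<in> borel_measurable M"
    and s [measurable]: "\<And>x. x \<in> X \<Longrightarrow> seed x \<in> borel_measurable M"
    using P by (auto simp: ppswor_seeds_def)
  let ?K = "\<lambda>w. PiM X (\<lambda>x. seed_dist (w x))"
  have K: "?K \<in> ?P \<rightarrow>\<^sub>M subprob_algebra ?Q"
    by (rule measurable_prob_algebraD[OF measurable_PiM_seed_dist[OF X]])
  have K2: "(\<lambda>w. ?K w \<bind> (\<lambda>s. return (?P \<Otimes>\<^sub>M ?Q) (w, s))) \<in> ?P \<rightarrow>\<^sub>M subprob_algebra (?P \<Otimes>\<^sub>M ?Q)"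
    by (rule measurable_bind[OF K]) measurable
  let ?A = "space ?P \<times> Pi\<^sub>E X B"
  have A2: "Pi\<^sub>E X B \<in> sets ?Q" using B by (intro sets_PiM_I_finite X) auto
  then have A: "?A \<in> sets (?P \<Otimes>\<^sub>M ?Q)" by auto
  have "emeasure M {\<omega>\<in>space M. \<forall>x\<in>X. seed x \<omega> \<in> B x}
    = emeasure (distr M (?P \<Otimes>\<^sub>M ?Q) (\<lambda>\<omega>. (\<lambda>x\<in>X. W x \<omega>, \<lambda>x\<in>X. seed x \<omega>))) ?A"
    using A by (subst emeasure_distr) (auto intro!: arg_cong[where f="emeasure M"] simp: space_PiM)
  also have "\<dots> = emeasure (?D \<bind> (\<lambda>w. ?K w \<bind> (\<lambda>s. return (?P \<Otimes>\<^sub>M ?Q) (w, s)))) ?A"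
    using P unfolding ppswor_seeds_def by simp
  also have "\<dots> = (\<integral>\<^sup>+w. emeasure (?K w \<bind> (\<lambda>s. return (?P \<Otimes>\<^sub>M ?Q) (w, s))) ?A \<partial>?D)"
    by (rule emeasure_bind) (use K2 A in \<open>auto simp: space_PiM\<close>)
  also have "\<dots> = (\<integral>\<^sup>+w. (\<Prod>x\<in>X. emeasure (seed_dist (w x)) (B x)) \<partial>?D)"
  proof (rule nn_integral_cong)
    fix w assume "w \<in> space ?D"
    then have w: "w \<in> space ?P" by simp
    have KQ [measurable_cong]: "sets (?K w) = sets ?Q" by (rule sets_PiM_cong) auto
    have "emeasure (?K w \<bind> (\<lambda>s. return (?P \<Otimes>\<^sub>M ?Q) (w, s))) ?A
      = emeasure (distr (?K w) (?P \<Otimes>\<^sub>M ?Q) (\<lambda>s. (w, s))) ?A"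
      by (subst bind_return_distr') (use w in \<open>auto simp: space_PiM\<close>)
    also have "\<dots> = emeasure (?K w) (Pi\<^sub>E X B)"
      using w A by (subst emeasure_distr) (auto intro!: arg_cong[where f="emeasure (?K w)"] simp: space_PiM)
    also have "\<dots> = (\<Prod>x\<in>X. emeasure (seed_dist (w x)) (B x))"
    proof -
      interpret product_sigma_finite "\<lambda>x. seed_dist (w x)"
        by (simp add: product_sigma_finite_def prob_space_seed_dist prob_space_imp_sigma_finite)
      show ?thesis by (rule emeasure_PiM) (use X B in auto)
    qed
    finally show "emeasure (?K w \<bind> (\<lambda>s. return (?P \<Otimes>\<^sub>M ?Q) (w, s))) ?A = \<dots>" .
  qed
  also have "\<dots> = (\<integral>\<^sup>+\<omega>. (\<Prod>x\<in>X. emeasure (seed_dist (W x \<omega>)) (B x)) \<partial>M)"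
    using B by (subst nn_integral_distr)
      (auto intro!: borel_measurable_prod_ennreal measurable_compose[OF _ measurable_emeasure_seed_dist] nn_integral_cong prod.cong)
  finally show ?thesis .
qed

text \<open>The other coordinates are left free; their factors are 1 because
  \<open>seed_dist\<close> is a probability measure for every rate.\<close>

lemma (in prob_space) emeasure_ppswor_seed:
  assumes X: "finite X" and P: "ppswor_seeds M X W seed" and x: "x \<in> X" and A: "A \<in> sets borel"
  shows "emeasure M {\<omega>\<in>space M. seed x \<omega> \<in> A} = (\<integral>\<^sup>+\<omega>. emeasure (seed_dist (W x \<omega>)) A \<partial>M)"
proof -
  have "emeasure M {\<omega>\<in>space M. \<forall>y\<in>X. seed y \<omega> \<in> (if y = x then A else UNIV)}
    = (\<integral>\<^sup>+\<omega>. (\<Prod>y\<in>X. emeasure (seed_dist (W y \<omega>)) (if y = x then A else UNIV)) \<partial>M)"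
    using A by (intro emeasure_ppswor_seeds[OF X P]) auto
  moreover have "(\<forall>y\<in>X. seed y \<omega> \<in> (if y = x then A else UNIV)) \<longleftrightarrow> seed x \<omega> \<in> A" for \<omega>
    using x by auto
  moreover have "emeasure (seed_dist w) (if y = x then A else UNIV)
      = (if y = x then emeasure (seed_dist w) A else 1)" for w y
    using prob_space.emeasure_space_1[OF prob_space_seed_dist, of w] by auto
  ultimately show ?thesis using X x by (simp add: prod.delta)
qed

text \<open>By construction the seeds are independent only conditionally on the weights.
  Independence of the weights removes the conditioning: the mean of the product over keys
  factors.\<close>

lemma (in prob_space) indep_vars_ppswor_seeds:
  assumes X: "finite X" "X \<noteq> {}" and P: "ppswor_seeds M X W seed"
    and ind: "indep_vars (\<lambda>_. borel) W X"
  shows "indep_vars (\<lambda>_. borel) seed X"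
proof -
  have s [measurable]: "\<And>x. x \<in> X \<Longrightarrow> seed x \<in> borel_measurable M"
    using P by (auto simp: ppswor_seeds_def)
  \<comment> \<open>The value outside \<open>X\<close> only makes \<open>D\<close> a family of
    probability measures over all indices, as the locale for product measures demands.\<close>
  define D where "D x = (if x \<in> X then distr M borel (seed x) else return borel 0)" for x
  have D: "prob_space (D x)" "sets (D x) = sets borel" for x
    by (auto simp: D_def prob_space_distr prob_space_return)
  interpret product_sigma_finite D
    by (simp add: product_sigma_finite_def D prob_space_imp_sigma_finite)
  have "distr M (PiM X (\<lambda>_. borel)) (\<lambda>\<omega>. \<lambda>x\<in>X. seed x \<omega>) = PiM X D"
  proof (rule PiM_eqI[OF X(1)])
    show "sets (distr M (PiM X (\<lambda>_. borel)) (\<lambda>\<omega>. \<lambda>x\<in>X. seed x \<omega>)) = sets (PiM X D)"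
      using D by (auto intro!: sets_PiM_cong)
    fix B assume "\<And>x. x \<in> X \<Longrightarrow> B x \<in> sets (D x)"
    then have B: "\<And>x. x \<in> X \<Longrightarrow> B x \<in> sets borel" using D by auto
    have "emeasure (distr M (PiM X (\<lambda>_. borel)) (\<lambda>\<omega>. \<lambda>x\<in>X. seed x \<omega>)) (Pi\<^sub>E X B)
      = emeasure M {\<omega>\<in>space M. \<forall>x\<in>X. seed x \<omega> \<in> B x}"
      using B X by (subst emeasure_distr)
        (auto intro!: arg_cong[where f="emeasure M"] sets_PiM_I_finite)
    also have "\<dots> = (\<integral>\<^sup>+\<omega>. (\<Prod>x\<in>X. emeasure (seed_dist (W x \<omega>)) (B x)) \<partial>M)"
      by (rule emeasure_ppswor_seeds[OF X(1) P B])
    also have "\<dots> = (\<Prod>x\<in>X. \<integral>\<^sup>+\<omega>. emeasure (seed_dist (W x \<omega>)) (B x) \<partial>M)"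
      by (rule indep_vars_nn_integral[OF X(1)])
        (use B in \<open>auto intro!: indep_vars_compose2[OF ind] measurable_emeasure_seed_dist\<close>)
    also have "\<dots> = (\<Prod>x\<in>X. emeasure (D x) (B x))"
      using B by (intro prod.cong refl)
        (simp add: D_def emeasure_distr emeasure_ppswor_seed[OF X(1) P, symmetric] vimage_def Int_def conj_commute)
    finally show "emeasure (distr M (PiM X (\<lambda>_. borel)) (\<lambda>\<omega>. \<lambda>x\<in>X. seed x \<omega>)) (Pi\<^sub>E X B) = \<dots>" .
  qed
  also have "PiM X D = PiM X (\<lambda>x. distr M borel (seed x))"
    by (rule PiM_cong) (auto simp: D_def)
  finally show ?thesis
    using X by (subst indep_vars_iff_distr_eq_PiM') auto
qed

subsection \<open>Threshold and bottom sample\<close>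

text \<open>In a sorted list the entries below \<open>u\<close> form a prefix.\<close>

lemma sorted_nth_less_iff:
  "sorted xs \<Longrightarrow> i < length xs \<Longrightarrow> xs ! i < u \<longleftrightarrow> i < length (filter (\<lambda>y. y < u) xs)"
proof (induction xs arbitrary: i)
  case (Cons a xs)
  show ?case
  proof (cases "a < u")
    case False
    with Cons.prems have "filter (\<lambda>y. y < u) (a # xs) = []"
      by (auto simp: filter_empty_conv)
    moreover have "\<not> (a # xs) ! i < u"
      using False Cons.prems by (cases i) (auto simp: not_less intro: order_trans nth_mem)
    ultimately show ?thesis by simp
  qed (use Cons in \<open>cases i; simp\<close>)
qed simp

text \<open>Turns the order statistic into a count; measurability, the sampling condition and the
  moment bound all go through this form. The default \<open>\<infinity>\<close> fits: it lies below
  no \<open>u\<close>, and then no \<open>u\<close> has \<open>j\<close> seeds below it.\<close>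

lemma threshold_less_iff:
  assumes X: "finite X" and j: "0 < j"
  shows "threshold j X s < u \<longleftrightarrow> j \<le> card {y\<in>X. s y < u}"
proof (cases "card {y\<in>X. s y < \<infinity>} < j")
  case True
  moreover have "card {y\<in>X. s y < u} \<le> card {y\<in>X. s y < \<infinity>}"
    using X by (intro card_mono) auto
  ultimately show ?thesis by (simp add: threshold_def)
next
  case False
  let ?xs = "sorted_list_of_multiset (image_mset s (mset_set X))"
  have "card {y\<in>X. s y < \<infinity>} \<le> card X" using X by (intro card_mono) auto
  with False j have len: "j - 1 < length ?xs"
    by (simp flip: size_mset)
  have "length (filter (\<lambda>y. y < u) ?xs) = card {y\<in>X. s y < u}"
    using X by (simp flip: size_mset add: filter_mset_image_mset)
  with sorted_nth_less_iff[of ?xs "j - 1" u] len False j show ?thesis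
    by (simp add: threshold_def) linarith
qed

text \<open>Lets the threshold be read as a function on the product space over \<open>X\<close>, as
  independence of blocks of seeds requires.\<close>

lemma threshold_restrict: "threshold j X (restrict s X) = threshold j X s"
proof -
  have "{y\<in>X. restrict s X y < \<infinity>} = {y\<in>X. s y < \<infinity>}" by auto
  moreover have "image_mset (restrict s X) (mset_set X) = image_mset s (mset_set X)"
    by (cases "finite X") (auto intro!: image_mset_cong)
  ultimately show ?thesis by (simp add: threshold_def)
qed

lemma borel_measurable_threshold:
  assumes X: "finite X" and j: "0 < j" and [measurable]: "\<And>y. y \<in> X \<Longrightarrow> f y \<in> borel_measurable M"
  shows "(\<lambda>\<omega>. threshold j X (\<lambda>y. f y \<omega>)) \<in> borel_measurable M"
proof (rule borel_measurableI_less)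
  fix u :: ereal
  have "card {y\<in>X. f y \<omega> < u} = (\<Sum>y\<in>X. if f y \<omega> < u then 1 else 0)" for \<omega>
    using X by (simp add: sum.If_cases Int_def)
  then have "{\<omega>\<in>space M. threshold j X (\<lambda>y. f y \<omega>) < u}
    = {\<omega>\<in>space M. j \<le> (\<Sum>y\<in>X. if f y \<omega> < u then 1 else 0 :: nat)}"
    using threshold_less_iff[OF X j] by auto
  then show "{\<omega>\<in>space M. threshold j X (\<lambda>y. f y \<omega>) < u} \<in> sets M" by simp
qed

text \<open>A key is never strictly below itself, so the count in \<open>bottom_sample\<close>
  involves the other keys only. This separates the seed of \<open>x\<close> from a statistic
  independent of it.\<close>

lemma mem_bottom_sample_iff:
  assumes X: "finite X" and k: "2 \<le> k" and x: "x \<in> X"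
  shows "x \<in> bottom_sample k X s \<longleftrightarrow> s x < \<infinity> \<and> s x \<le> threshold (k - 1) (X - {x}) s"
proof -
  have "{y\<in>X. s y < s x} = {y\<in>X - {x}. s y < s x}" by auto
  then show ?thesis
    using threshold_less_iff[of "X - {x}" "k - 1" s "s x"] X k x
    by (auto simp: bottom_sample_def simp flip: not_less)
qed

text \<open>At levels above \<open>s x\<close> the key \<open>x\<close> adds exactly one to the
  count, which matches the shift from \<open>k - 1\<close> to \<open>k\<close>; at levels up to
  \<open>s x\<close> both counts stay below \<open>k - 1\<close>.\<close>

lemma threshold_bottom_sample:
  assumes X: "finite X" and k: "2 \<le> k" and "x \<in> bottom_sample k X s"
  shows "threshold k X s = threshold (k - 1) (X - {x}) s"
proof -
  have x: "x \<in> X" and c: "card {y\<in>X. s y < s x} < k - 1"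
    using assms by (auto simp: bottom_sample_def)
  have "threshold k X s < u \<longleftrightarrow> threshold (k - 1) (X - {x}) s < u" for u
  proof (cases "s x < u")
    case True
    then have "{y\<in>X. s y < u} = insert x {y\<in>X - {x}. s y < u}" using x by auto
    then have "card {y\<in>X. s y < u} = Suc (card {y\<in>X - {x}. s y < u})"
      using X by simp
    then show ?thesis using X k by (auto simp: threshold_less_iff)
  next
    case False
    then have "card {y\<in>X. s y < u} \<le> card {y\<in>X. s y < s x}"
      and "card {y\<in>X - {x}. s y < u} \<le> card {y\<in>X. s y < s x}"
      using X by (auto intro!: card_mono)
    then show ?thesis using X k c by (auto simp: threshold_less_iff)
  qed
  then show ?thesis by (meson less_irrefl neqE)
qed

subsection \<open>Tail bounds\<close>

text \<open>Applied twice in the main proof, at \<open>c = v x * u\<close> and at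
  \<open>c = T * t\<close>.\<close>

lemma inverse_one_minus_exp_le:
  fixes c :: real
  assumes "c > 0"
  shows "1 / (1 - exp (- c)) \<le> 1 + 1 / c"
proof -
  have "1 + c \<le> exp c" by simp
  then have "(1 + c) * exp (- c) \<le> 1" by (simp add: exp_minus field_simps)
  then show ?thesis using assms by (simp add: field_simps)
qed

text \<open>The bound is affine in \<open>s\<close>, so after taking expectations only the mean of
  \<open>s\<close> remains.\<close>

lemma exp_minus_le_chord:
  fixes s t T :: real
  assumes "0 \<le> s" "s \<le> T" "T > 0"
  shows "exp (- s * t) \<le> 1 - s * ((1 - exp (- T * t)) / T)"
proof -
  have "exp ((1 - s / T) *\<^sub>R 0 + (s / T) *\<^sub>R (- T * t)) \<le> (1 - s / T) * exp 0 + (s / T) * exp (- T * t)"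
    using assms by (intro convex_onD[OF exp_convex]) auto
  then show ?thesis using assms by (simp add: diff_divide_distrib right_diff_distrib)
qed

text \<open>Independence factors the exponential, the chord bound leaves only a mean in each factor,
  and \<open>1 + y \<le> exp y\<close> recombines the factors. Since \<open>T\<close> bounds single
  summands, their number does not enter.\<close>

lemma (in prob_space) expectation_exp_minus_sum_le:
  fixes t T :: real
  assumes I: "finite I" and ind: "indep_vars (\<lambda>_. borel) Y I"
    and range: "\<And>i \<omega>. i \<in> I \<Longrightarrow> \<omega> \<in> space M \<Longrightarrow> Y i \<omega> \<in> {0..T}"
    and T: "T > 0" and t: "t \<ge> 0"
  shows "expectation (\<lambda>\<omega>. exp (- (\<Sum>i\<in>I. Y i \<omega>) * t))
    \<le> exp (- expectation (\<lambda>\<omega>. \<Sum>i\<in>I. Y i \<omega>) * ((1 - exp (- T * t)) / T))"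
proof -
  have [measurable]: "\<And>i. i \<in> I \<Longrightarrow> Y i \<in> borel_measurable M"
    using ind by (auto simp: indep_vars_def)
  have intY: "integrable M (Y i)" if "i \<in> I" for i
    using that range by (intro integrable_const_bound[where B=T] AE_I2) auto
  have intE: "integrable M (\<lambda>\<omega>. exp (- Y i \<omega> * t))" if "i \<in> I" for i
    using that range t by (intro integrable_const_bound[where B=1] AE_I2) auto
  define u where "u = (1 - exp (- T * t)) / T"
  have "expectation (\<lambda>\<omega>. exp (- (\<Sum>i\<in>I. Y i \<omega>) * t)) = expectation (\<lambda>\<omega>. \<Prod>i\<in>I. exp (- Y i \<omega> * t))"
    using I by (simp add: sum_distrib_right exp_sum flip: sum_negf)
  also have "\<dots> = (\<Prod>i\<in>I. expectation (\<lambda>\<omega>. exp (- Y i \<omega> * t)))"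
    using I intE by (intro indep_vars_lebesgue_integral indep_vars_compose2[OF ind]) auto
  also have "\<dots> \<le> (\<Prod>i\<in>I. exp (- expectation (Y i) * u))"
  proof (intro prod_mono conjI)
    fix i assume i: "i \<in> I"
    have "expectation (\<lambda>\<omega>. exp (- Y i \<omega> * t)) \<le> expectation (\<lambda>\<omega>. 1 - Y i \<omega> * u)"
      using i intE intY range T unfolding u_def by (intro integral_mono exp_minus_le_chord) auto
    also have "\<dots> = 1 + - expectation (Y i) * u"
      using intY[OF i] by (simp add: prob_space)
    also have "\<dots> \<le> exp (- expectation (Y i) * u)" by (rule exp_ge_add_one_self)
    finally show "expectation (\<lambda>\<omega>. exp (- Y i \<omega> * t)) \<le> exp (- expectation (Y i) * u)" .
  qed simp
  also have "\<dots> = exp (- expectation (\<lambda>\<omega>. \<Sum>i\<in>I. Y i \<omega>) * u)"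
    using I intY by (simp add: sum_distrib_right exp_sum flip: sum_negf)
  finally show ?thesis unfolding u_def .
qed

lemma (in prob_space) prob_ppswor_seed_less:
  assumes X: "finite X" and P: "ppswor_seeds M X W seed" and x: "x \<in> X"
    and W: "\<And>\<omega>. \<omega> \<in> space M \<Longrightarrow> 0 \<le> W x \<omega>" and t: "0 < t"
  shows "prob {\<omega>\<in>space M. seed x \<omega> < ereal t} = 1 - expectation (\<lambda>\<omega>. exp (- W x \<omega> * t))"
proof -
  have [measurable]: "W x \<in> borel_measurable M" using P x by (auto simp: ppswor_seeds_def)
  have int: "integrable M (\<lambda>\<omega>. exp (- W x \<omega> * t))"
    using W t by (intro integrable_const_bound[where B=1] AE_I2) auto
  have "emeasure M {\<omega>\<in>space M. seed x \<omega> < ereal t} = (\<integral>\<^sup>+\<omega>. ennreal (1 - exp (- W x \<omega> * t)) \<partial>M)"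
    using emeasure_ppswor_seed[OF X P x, of "{..<ereal t}"] W t
    by (simp add: emeasure_seed_dist_less cong: nn_integral_cong)
  also have "\<dots> = ennreal (expectation (\<lambda>\<omega>. 1 - exp (- W x \<omega> * t)))"
    using W t int by (intro nn_integral_eq_integral AE_I2) auto
  also have "expectation (\<lambda>\<omega>. 1 - exp (- W x \<omega> * t)) = 1 - expectation (\<lambda>\<omega>. exp (- W x \<omega> * t))"
    using int by (simp add: prob_space)
  finally have "ennreal (prob {\<omega>\<in>space M. seed x \<omega> < ereal t}) = \<dots>"
    by (simp add: emeasure_eq_measure)
  \<comment> \<open>Makes the right-hand side nonnegative, without which \<open>ennreal\<close>
    cannot be cancelled.\<close>
  moreover have "expectation (\<lambda>\<omega>. exp (- W x \<omega> * t)) \<le> expectation (\<lambda>\<omega>. 1)"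
    using W t int by (intro integral_mono) auto
  ultimately show ?thesis by (simp add: prob_space)
qed

lemma (in prob_space) prob_ppswor_seed_less_le:
  assumes X: "finite X" and P: "ppswor_seeds M X W seed" and x: "x \<in> X"
    and W: "\<And>\<omega>. \<omega> \<in> space M \<Longrightarrow> 0 \<le> W x \<omega>" "integrable M (W x)" and t: "0 < t"
  shows "prob {\<omega>\<in>space M. seed x \<omega> < ereal t} \<le> expectation (W x) * t"
proof -
  have "1 - expectation (W x) * t = expectation (\<lambda>\<omega>. 1 - W x \<omega> * t)"
    using W by (simp add: prob_space)
  also have "\<dots> \<le> expectation (\<lambda>\<omega>. exp (- W x \<omega> * t))"
  proof (rule integral_mono)
    show "integrable M (\<lambda>\<omega>. exp (- W x \<omega> * t))"
      using W t by (intro integrable_const_bound[where B=1] AE_I2) auto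
    show "1 - W x \<omega> * t \<le> exp (- W x \<omega> * t)" for \<omega>
      using exp_ge_add_one_self[of "- W x \<omega> * t"] by simp
  qed (use W in simp)
  finally show ?thesis
    using prob_ppswor_seed_less[where W=W, OF X P x W(1) t] by simp
qed

text \<open>The guard against infinite seeds matters at \<open>z = \<infinity>\<close>, where a zero
  weight creates an atom; elsewhere the seed has none.\<close>

lemma (in prob_space) prob_ppswor_seed_le:
  assumes X: "finite X" and P: "ppswor_seeds M X W seed" and x: "x \<in> X"
  shows "prob {\<omega>\<in>space M. seed x \<omega> < \<infinity> \<and> seed x \<omega> \<le> z} = prob {\<omega>\<in>space M. seed x \<omega> < z}"
proof (cases "z = \<infinity>")
  case False
  have [measurable]: "seed x \<in> borel_measurable M" using P x by (auto simp: ppswor_seeds_def)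
  have "emeasure M {\<omega>\<in>space M. seed x \<omega> \<in> {z}} = 0"
    using False emeasure_ppswor_seed[OF X P x, of "{z}"] by (simp add: emeasure_seed_dist_singleton)
  then have "AE \<omega> in M. seed x \<omega> \<noteq> z" by (subst AE_iff_measurable) auto
  then show ?thesis
    using False by (intro finite_measure_eq_AE) (auto elim!: eventually_mono)
qed (auto intro!: arg_cong[where f=prob])

text \<open>A first-moment bound would be linear in the sum of probabilities, hence linear in
  \<open>t\<close> later on, and not integrable against \<open>1 / t\<^sup>2\<close> near 0. The
  second moment gives the quadratic decay.\<close>

lemma (in prob_space) prob_threshold_less_le:
  assumes X: "finite X" and j: "2 \<le> j" and ind: "indep_vars (\<lambda>_. borel) f X"
  shows "prob {\<omega>\<in>space M. threshold j X (\<lambda>y. f y \<omega>) < u}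
    \<le> (\<Sum>y\<in>X. prob {\<omega>\<in>space M. f y \<omega> < u})\<^sup>2 / (real j * (real j - 1))"
proof -
  have [measurable]: "\<And>y. y \<in> X \<Longrightarrow> f y \<in> borel_measurable M"
    using ind by (auto simp: indep_vars_def)
  define A where "A y = {\<omega>\<in>space M. f y \<omega> < u}" for y
  have A [measurable]: "y \<in> X \<Longrightarrow> A y \<in> sets M" for y by (simp add: A_def)
  have pair: "prob (A y \<inter> A z) = prob (A y) * prob (A z)" if "y \<in> X" "z \<in> X - {y}" for y z
    using indep_varsD[OF ind, of "{y, z}" "\<lambda>_. {..<u}"] that
    by (auto simp: A_def vimage_def Int_def conj_ac)
  \<comment> \<open>\<open>?N\<close> counts the ordered pairs of distinct keys below \<open>u\<close>: Markov's inequality for the second factorial moment.\<close>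
  let ?N = "\<lambda>\<omega>. \<Sum>y\<in>X. \<Sum>z\<in>X - {y}. indicator (A y \<inter> A z) \<omega> :: real"
  let ?B = "{\<omega>\<in>space M. threshold j X (\<lambda>y. f y \<omega>) < u}"
  have jj: "0 < real j * (real j - 1)" using j by simp
  have N: "real j * (real j - 1) \<le> ?N \<omega>" if "\<omega> \<in> ?B" for \<omega>
  proof -
    define n where "n = card {y\<in>X. f y \<omega> < u}"
    have n: "real n = (\<Sum>y\<in>X. indicator (A y) \<omega>)"
      using X that by (simp add: n_def A_def indicator_def sum.If_cases Int_def)
    have "?N \<omega> = (\<Sum>y\<in>X. indicator (A y) \<omega> * (real n - indicator (A y) \<omega>))"
    proof (rule sum.cong)
      fix y assume "y \<in> X"
      then have "(\<Sum>z\<in>X - {y}. indicator (A z) \<omega> :: real) = real n - indicator (A y) \<omega>"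
        using X by (simp only: n sum_diff1 if_True)
      then show "(\<Sum>z\<in>X - {y}. indicator (A y \<inter> A z) \<omega>) = indicator (A y) \<omega> * (real n - indicator (A y) \<omega>)"
        by (simp only: indicator_inter_arith flip: sum_distrib_left)
    qed simp
    \<comment> \<open>An indicator equals its own square.\<close>
    also have "\<dots> = (\<Sum>y\<in>X. indicator (A y) \<omega> * (real n - 1))"
      by (intro sum.cong) (auto split: split_indicator)
    also have "\<dots> = real n * (real n - 1)" by (simp add: n flip: sum_distrib_right)
    finally have "?N \<omega> = real n * (real n - 1)" .
    moreover have "j \<le> n" using that X j threshold_less_iff[OF X, of j] by (simp add: n_def)
    ultimately show ?thesis using j by (auto intro!: mult_mono)
  qed
  have "real j * (real j - 1) * prob ?B = expectation (\<lambda>\<omega>. real j * (real j - 1) * indicator ?B \<omega>)"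
    by (simp add: Int_def conj_ac)
  also have "\<dots> \<le> expectation ?N"
  proof (rule integral_mono)
    have [measurable]: "(\<lambda>\<omega>. threshold j X (\<lambda>y. f y \<omega>)) \<in> borel_measurable M"
      using X j by (intro borel_measurable_threshold) auto
    show "integrable M (\<lambda>\<omega>. real j * (real j - 1) * indicator ?B \<omega>)"
      by (intro integrable_mult_right integrable_real_indicator) (auto simp: emeasure_eq_measure)
    show "integrable M ?N"
      by (intro Bochner_Integration.integrable_sum) (auto intro!: integrable_real_indicator simp: emeasure_eq_measure)
    show "real j * (real j - 1) * indicator ?B \<omega> \<le> ?N \<omega>" for \<omega>
      using N[of \<omega>] by (auto intro!: sum_nonneg split: split_indicator)
  qed
  also have "expectation ?N = (\<Sum>y\<in>X. \<Sum>z\<in>X - {y}. prob (A y) * prob (A z))"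
  proof -
    have int: "integrable M (indicator (A y \<inter> A z) :: 'a \<Rightarrow> real)" if "y \<in> X" "z \<in> X" for y z
      using that by (intro integrable_real_indicator) (auto simp: emeasure_eq_measure)
    have "A y \<inter> A z \<inter> space M = A y \<inter> A z" for y z by (auto simp: A_def)
    then have "expectation (indicator (A y \<inter> A z)) = prob (A y) * prob (A z)"
      if "y \<in> X" "z \<in> X - {y}" for y z
      using pair[OF that] by simp
    then have "expectation (\<lambda>\<omega>. \<Sum>z\<in>X - {y}. indicator (A y \<inter> A z) \<omega>)
        = (\<Sum>z\<in>X - {y}. prob (A y) * prob (A z))" if "y \<in> X" for y
      using that int by (subst Bochner_Integration.integral_sum) (auto intro!: sum.cong)
    then show ?thesis
      using int by (subst Bochner_Integration.integral_sum)
        (auto intro!: sum.cong Bochner_Integration.integrable_sum)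
  qed
  \<comment> \<open>Adding the diagonal terms completes the square.\<close>
  also have "\<dots> \<le> (\<Sum>y\<in>X. \<Sum>z\<in>X. prob (A y) * prob (A z))"
    using X by (intro sum_mono sum_mono2) auto
  also have "\<dots> = (\<Sum>y\<in>X. prob (A y))\<^sup>2"
    by (simp add: power2_eq_square sum_product)
  finally show ?thesis
    using jj by (simp add: A_def field_simps)
qed

subsection \<open>Variance of inverse-probability estimators\<close>

text \<open>A negative \<open>b\<close> is allowed, since \<open>ennreal\<close> truncates it to
  0.\<close>

lemma ennreal_plus_le: "0 \<le> a \<Longrightarrow> ennreal (a + b) \<le> ennreal a + ennreal b"
  by (cases "0 \<le> b") (simp_all add: ennreal_neg ennreal_leI)

text \<open>At \<open>z = \<infinity>\<close> the left-hand side is \<open>0\<close>, because \<open>real_of_ereal \<infinity> = 0\<close> and \<open>1 / 0 = 0\<close>.\<close>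

lemma ennreal_inverse_le_layers:
  fixes a :: real and z :: ereal
  assumes a: "a > 0"
  shows "ennreal (1 / real_of_ereal z)
    \<le> ennreal (1 / a) + (\<integral>\<^sup>+t. ennreal (1 / t\<^sup>2) * indicator {0<..<a} t * indicator {z<..} (ereal t) \<partial>lborel)"
proof (cases "0 < real_of_ereal z \<and> real_of_ereal z < a")
  case True
  then obtain r where r: "z = ereal r" "0 < r" "r < a" by (cases z) auto
  \<comment> \<open>The open conditions of the layer integral differ from the closed interval
    required by the fundamental theorem only in these two points.\<close>
  have "AE t in lborel. t \<noteq> r" "AE t in lborel. t \<noteq> a"
    by (rule AE_lborel_singleton)+
  then have ae: "AE t in lborel. ennreal (1 / t\<^sup>2) * indicator {r..a} t
      \<le> ennreal (1 / t\<^sup>2) * indicator {0<..<a} t * indicator {z<..} (ereal t)"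
    by eventually_elim (use r in \<open>auto split: split_indicator\<close>)
  have "(\<integral>\<^sup>+t. ennreal (1 / t\<^sup>2) * indicator {r..a} t \<partial>lborel) = ennreal (- (1 / a) - (- (1 / r)))"
    by (rule nn_integral_FTC_Icc)
      (use r in \<open>auto intro!: derivative_eq_intros simp: power2_eq_square field_simps\<close>)
  then have "ennreal (1 / r) = ennreal (1 / a) + (\<integral>\<^sup>+t. ennreal (1 / t\<^sup>2) * indicator {r..a} t \<partial>lborel)"
    using r a by (simp add: field_simps flip: ennreal_plus)
  also have "\<dots> \<le> ennreal (1 / a)
      + (\<integral>\<^sup>+t. ennreal (1 / t\<^sup>2) * indicator {0<..<a} t * indicator {z<..} (ereal t) \<partial>lborel)"
    by (intro add_left_mono nn_integral_mono_AE ae)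
  finally show ?thesis using r by simp
next
  case False
  then have "1 / real_of_ereal z \<le> 1 / a"
    using a by (auto simp: field_simps divide_le_0_iff not_less intro: order_trans[of _ 0])
  then have "ennreal (1 / real_of_ereal z) \<le> ennreal (1 / a)" by (rule ennreal_leI)
  then show ?thesis by (rule add_increasing2[rotated]) simp
qed

text \<open>Truncating at \<open>a\<close> costs \<open>1 / a\<close>. For the rest, exchanging the
  integrals produces the tail probability, whose factor \<open>t\<^sup>2\<close> cancels the weight
  \<open>1 / t\<^sup>2\<close>, so integration over an interval of length \<open>a\<close> gives
  \<open>c * a\<close>.\<close>

lemma (in prob_space) nn_integral_inverse_le:
  fixes Z :: "'a \<Rightarrow> ereal" and a c :: real
  assumes [measurable]: "Z \<in> borel_measurable M" and a: "a > 0" and c: "c \<ge> 0"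
    and tail: "\<And>t. 0 < t \<Longrightarrow> prob {\<omega>\<in>space M. Z \<omega> < ereal t} \<le> c * t\<^sup>2"
  shows "(\<integral>\<^sup>+\<omega>. ennreal (1 / real_of_ereal (Z \<omega>)) \<partial>M) \<le> ennreal (1 / a + c * a)"
proof -
  interpret pair_sigma_finite M lborel ..
  let ?f = "\<lambda>\<omega> t. ennreal (1 / t\<^sup>2) * indicator {0<..<a} t * indicator {Z \<omega><..} (ereal t)"
  have "(\<integral>\<^sup>+\<omega>. ennreal (1 / real_of_ereal (Z \<omega>)) \<partial>M)
    \<le> (\<integral>\<^sup>+\<omega>. ennreal (1 / a) + (\<integral>\<^sup>+t. ?f \<omega> t \<partial>lborel) \<partial>M)"
    by (intro nn_integral_mono ennreal_inverse_le_layers a)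
  also have "\<dots> = ennreal (1 / a) + (\<integral>\<^sup>+\<omega>. \<integral>\<^sup>+t. ?f \<omega> t \<partial>lborel \<partial>M)"
    by (subst nn_integral_add) (auto simp: emeasure_space_1 indicator_def cong: measurable_cong)
  also have "(\<integral>\<^sup>+\<omega>. \<integral>\<^sup>+t. ?f \<omega> t \<partial>lborel \<partial>M) = (\<integral>\<^sup>+t. \<integral>\<^sup>+\<omega>. ?f \<omega> t \<partial>M \<partial>lborel)"
    by (rule Fubini'[symmetric]) (simp add: indicator_def)
  also have "\<dots> \<le> (\<integral>\<^sup>+t. ennreal c * indicator {0<..<a} t \<partial>lborel)"
  proof (rule nn_integral_mono)
    fix t :: real
    have "(\<integral>\<^sup>+\<omega>. ?f \<omega> t \<partial>M)
      = ennreal (1 / t\<^sup>2) * indicator {0<..<a} t * emeasure M {\<omega>\<in>space M. Z \<omega> < ereal t}"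
    proof -
      have "(\<integral>\<^sup>+\<omega>. indicator {Z \<omega><..} (ereal t) \<partial>M) = (\<integral>\<^sup>+\<omega>. indicator {\<omega>\<in>space M. Z \<omega> < ereal t} \<omega> \<partial>M)"
        by (intro nn_integral_cong) (auto split: split_indicator)
      also have "\<dots> = emeasure M {\<omega>\<in>space M. Z \<omega> < ereal t}" by simp
      finally have "(\<integral>\<^sup>+\<omega>. indicator {Z \<omega><..} (ereal t) \<partial>M) = \<dots>" .
      moreover have "(\<lambda>\<omega>. indicator {Z \<omega><..} (ereal t) :: ennreal) \<in> borel_measurable M"
        by (simp add: indicator_def)
      ultimately show ?thesis by (simp add: nn_integral_cmult)
    qed
    also have "\<dots> \<le> ennreal c * indicator {0<..<a} t"
    proof (cases "t \<in> {0<..<a}")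
      case True
      then have "1 / t\<^sup>2 * prob {\<omega>\<in>space M. Z \<omega> < ereal t} \<le> c"
        using tail[of t] by (simp add: field_simps)
      then show ?thesis
        using True by (simp add: emeasure_eq_measure ennreal_leI flip: ennreal_mult)
    qed simp
    finally show "(\<integral>\<^sup>+\<omega>. ?f \<omega> t \<partial>M) \<le> ennreal c * indicator {0<..<a} t" .
  qed
  also have "\<dots> = ennreal (c * a)"
    using a c by (simp add: nn_integral_cmult_indicator flip: ennreal_mult)
  finally show ?thesis using a c by (simp add: ennreal_plus add_left_mono)
qed

text \<open>Given \<open>Z\<close>, the estimator is nonzero with probability
  \<open>p (Z \<omega>)\<close> when \<open>v > 0\<close>: the conditional mean is \<open>v\<close>
  and the conditional second moment \<open>v\<^sup>2 / p (Z \<omega>)\<close>. The bounds are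
  assumed abstractly, without reference to PPSWOR.\<close>

lemma (in prob_space) variance_inverse_probability:
  fixes s Z :: "'a \<Rightarrow> ereal" and v c B :: real
  defines "p \<equiv> \<lambda>z. prob {\<omega>\<in>space M. s \<omega> < z}"
  defines "est \<equiv> \<lambda>\<omega>. if s \<omega> < \<infinity> \<and> s \<omega> \<le> Z \<omega> then v / p (Z \<omega>) else 0"
  assumes ind: "indep_var borel s borel Z"
    and no_atom: "\<And>z. prob {\<omega>\<in>space M. s \<omega> < \<infinity> \<and> s \<omega> \<le> z} = p z"
    and v: "v \<ge> 0" and c: "c \<ge> 0" and B: "B \<ge> 0"
    and pos: "AE \<omega> in M. 0 < p (Z \<omega>)"
    and bound: "AE \<omega> in M. v * (1 / p (Z \<omega>) - 1) \<le> c + 1 / real_of_ereal (Z \<omega>)"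
    and expZ: "(\<integral>\<^sup>+\<omega>. ennreal (1 / real_of_ereal (Z \<omega>)) \<partial>M) \<le> ennreal B"
  shows "integrable M est" "integrable M (\<lambda>\<omega>. (est \<omega>)\<^sup>2)" "variance est \<le> v * (c + B)"
proof -
  have sM [measurable]: "s \<in> borel_measurable M" and ZM [measurable]: "Z \<in> borel_measurable M"
    using ind by (auto dest: indep_var_rv1 indep_var_rv2)
  \<comment> \<open>\<open>p z\<close> is the mass, under the law of \<open>s\<close>, of the
    section at \<open>z\<close> of a measurable subset of the plane.\<close>
  have pM [measurable]: "p \<in> borel_measurable borel"
  proof -
    interpret D: prob_space "distr M borel s" by (rule prob_space_distr) simp
    have "{q \<in> space (borel \<Otimes>\<^sub>M borel). snd q < fst q} \<in> sets (borel \<Otimes>\<^sub>M (borel :: ereal measure))"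
      by measurable
    then have "{(z, x). x < z} \<in> sets (borel \<Otimes>\<^sub>M (borel :: ereal measure))"
      by (simp add: space_pair_measure case_prod_beta')
    then have "(\<lambda>z. emeasure (distr M borel s) (Pair z -` {(z, x). x < z})) \<in> borel_measurable borel"
      by (intro D.measurable_emeasure_Pair) simp
    then have "(\<lambda>z. enn2real (emeasure (distr M borel s) (Pair z -` {(z, x). x < z}))) \<in> borel_measurable borel"
      by (rule borel_measurable_enn2real)
    moreover have "enn2real (emeasure (distr M borel s) (Pair z -` {(z, x). x < z})) = p z" for z
      by (simp add: p_def measure_def emeasure_distr vimage_def Int_def conj_commute)
    ultimately show ?thesis by (simp only:)
  qed
  have p0: "0 \<le> p z" for z by (simp add: p_def)
  have estM [measurable]: "est \<in> borel_measurable M" unfolding est_def by measurable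
  have est0: "0 \<le> est \<omega>" for \<omega> using v p0 by (simp add: est_def)
  \<comment> \<open>Conditioning on \<open>Z\<close>: the joint law is a product, so
    \<open>s\<close> is integrated out first with \<open>Z\<close> held fixed, and
    \<open>no_atom\<close> evaluates the inner mass.\<close>
  have indep: "(\<integral>\<^sup>+\<omega>. g (Z \<omega>) * indicator {\<omega>. s \<omega> < \<infinity> \<and> s \<omega> \<le> Z \<omega>} \<omega> \<partial>M)
      = (\<integral>\<^sup>+\<omega>. g (Z \<omega>) * ennreal (p (Z \<omega>)) \<partial>M)"
    if [measurable]: "g \<in> borel_measurable borel" for g :: "ereal \<Rightarrow> ennreal"
  proof -
    interpret S: prob_space "distr M borel s" by (rule prob_space_distr) simp
    interpret Z: prob_space "distr M borel Z" by (rule prob_space_distr) simp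
    interpret pair_sigma_finite "distr M borel s" "distr M borel Z" ..
    let ?h = "\<lambda>x z. g z * indicator {x. x < \<infinity> \<and> x \<le> z} x"
    have [measurable]: "(\<lambda>(x, z). ?h x z) \<in> borel_measurable (borel \<Otimes>\<^sub>M borel)"
      by (simp add: indicator_def)
    have "(\<integral>\<^sup>+\<omega>. g (Z \<omega>) * indicator {\<omega>. s \<omega> < \<infinity> \<and> s \<omega> \<le> Z \<omega>} \<omega> \<partial>M)
      = (\<integral>\<^sup>+\<omega>. (\<lambda>(x, z). ?h x z) (s \<omega>, Z \<omega>) \<partial>M)"
      by (intro nn_integral_cong) (simp split: split_indicator)
    also have "\<dots> = (\<integral>\<^sup>+y. (\<lambda>(x, z). ?h x z) y \<partial>(distr M (borel \<Otimes>\<^sub>M borel) (\<lambda>\<omega>. (s \<omega>, Z \<omega>))))"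
      by (rule nn_integral_distr[symmetric]) simp_all
    also have "\<dots> = (\<integral>\<^sup>+y. (\<lambda>(x, z). ?h x z) y \<partial>(distr M borel s \<Otimes>\<^sub>M distr M borel Z))"
      using ind by (simp add: indep_var_distribution_eq)
    also have "\<dots> = (\<integral>\<^sup>+z. \<integral>\<^sup>+x. ?h x z \<partial>distr M borel s \<partial>distr M borel Z)"
      by (subst nn_integral_snd[symmetric]) (auto cong: measurable_cong_sets)
    also have "\<dots> = (\<integral>\<^sup>+z. g z * ennreal (p z) \<partial>distr M borel Z)"
    proof (rule nn_integral_cong)
      fix z :: ereal
      have "(\<integral>\<^sup>+x. ?h x z \<partial>distr M borel s) = g z * emeasure (distr M borel s) {x. x < \<infinity> \<and> x \<le> z}"
        by (subst nn_integral_cmult_indicator) simp_all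
      also have "emeasure (distr M borel s) {x. x < \<infinity> \<and> x \<le> z} = ennreal (p z)"
        by (simp add: emeasure_distr vimage_def Int_def conj_ac no_atom[symmetric] emeasure_eq_measure)
      finally show "(\<integral>\<^sup>+x. ?h x z \<partial>distr M borel s) = g z * ennreal (p z)" .
    qed
    also have "\<dots> = (\<integral>\<^sup>+\<omega>. g (Z \<omega>) * ennreal (p (Z \<omega>)) \<partial>M)"
      by (rule nn_integral_distr) simp_all
    finally show ?thesis .
  qed
  have "(\<integral>\<^sup>+\<omega>. ennreal (est \<omega>) \<partial>M)
      = (\<integral>\<^sup>+\<omega>. ennreal (v / p (Z \<omega>)) * indicator {\<omega>. s \<omega> < \<infinity> \<and> s \<omega> \<le> Z \<omega>} \<omega> \<partial>M)"
    by (intro nn_integral_cong) (simp add: est_def split: split_indicator)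
  also have "\<dots> = (\<integral>\<^sup>+\<omega>. ennreal (v / p (Z \<omega>)) * ennreal (p (Z \<omega>)) \<partial>M)"
    \<comment> \<open>Next, \<open>pos\<close> permits the cancellation of
      \<open>p (Z \<omega>)\<close>; where it vanished, the quotient would be 0 by convention and
      the mean too small.\<close>
    by (rule indep) simp
  also have "\<dots> = (\<integral>\<^sup>+\<omega>. ennreal v \<partial>M)"
    by (rule nn_integral_cong_AE, use pos in eventually_elim) (simp add: v p0 flip: ennreal_mult)
  also have "\<dots> = ennreal v" by (simp add: emeasure_space_1)
  finally have est_nn: "(\<integral>\<^sup>+\<omega>. ennreal (est \<omega>) \<partial>M) = ennreal v" .
  have "(\<integral>\<^sup>+\<omega>. ennreal ((est \<omega>)\<^sup>2) \<partial>M)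
      = (\<integral>\<^sup>+\<omega>. ennreal ((v / p (Z \<omega>))\<^sup>2) * indicator {\<omega>. s \<omega> < \<infinity> \<and> s \<omega> \<le> Z \<omega>} \<omega> \<partial>M)"
    by (intro nn_integral_cong) (simp add: est_def split: split_indicator)
  also have "\<dots> = (\<integral>\<^sup>+\<omega>. ennreal ((v / p (Z \<omega>))\<^sup>2) * ennreal (p (Z \<omega>)) \<partial>M)"
    by (rule indep) simp
  also have "\<dots> \<le> (\<integral>\<^sup>+\<omega>. ennreal (v\<^sup>2 + v * c) + ennreal v * ennreal (1 / real_of_ereal (Z \<omega>)) \<partial>M)"
  proof (rule nn_integral_mono_AE, use pos bound in eventually_elim)
    fix \<omega> assume p: "0 < p (Z \<omega>)"
      and b: "v * (1 / p (Z \<omega>) - 1) \<le> c + 1 / real_of_ereal (Z \<omega>)"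
    have "ennreal ((v / p (Z \<omega>))\<^sup>2) * ennreal (p (Z \<omega>)) = ennreal (v\<^sup>2 + v * (v * (1 / p (Z \<omega>) - 1)))"
      using p by (simp add: power2_eq_square field_simps flip: ennreal_mult)
    also have "\<dots> \<le> ennreal (v\<^sup>2 + v * (c + 1 / real_of_ereal (Z \<omega>)))"
      using v b by (intro ennreal_leI add_left_mono mult_left_mono)
    also have "\<dots> = ennreal (v\<^sup>2 + v * c + v * (1 / real_of_ereal (Z \<omega>)))"
      by (simp add: algebra_simps)
    \<comment> \<open>Only an inequality, as the sign of \<open>Z\<close> is not known here.\<close>
    also have "\<dots> \<le> ennreal (v\<^sup>2 + v * c) + ennreal (v * (1 / real_of_ereal (Z \<omega>)))"
      using v c by (intro ennreal_plus_le) simp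
    also have "ennreal (v * (1 / real_of_ereal (Z \<omega>))) = ennreal v * ennreal (1 / real_of_ereal (Z \<omega>))"
      using v by (rule ennreal_mult')
    finally show "ennreal ((v / p (Z \<omega>))\<^sup>2) * ennreal (p (Z \<omega>))
      \<le> ennreal (v\<^sup>2 + v * c) + ennreal v * ennreal (1 / real_of_ereal (Z \<omega>))" .
  qed
  also have "\<dots> = ennreal (v\<^sup>2 + v * c) + ennreal v * (\<integral>\<^sup>+\<omega>. ennreal (1 / real_of_ereal (Z \<omega>)) \<partial>M)"
    by (simp add: nn_integral_add nn_integral_cmult emeasure_space_1)
  also have "\<dots> \<le> ennreal (v\<^sup>2 + v * c) + ennreal v * ennreal B"
    by (intro add_left_mono mult_left_mono expZ) simp
  also have "\<dots> = ennreal (v\<^sup>2 + v * (c + B))"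
    using v c B by (simp add: algebra_simps flip: ennreal_mult ennreal_plus)
  finally have sq: "(\<integral>\<^sup>+\<omega>. ennreal ((est \<omega>)\<^sup>2) \<partial>M) \<le> ennreal (v\<^sup>2 + v * (c + B))" .
  show int: "integrable M est"
    using est0 est_nn by (intro integrableI_nonneg) auto
  show int2: "integrable M (\<lambda>\<omega>. (est \<omega>)\<^sup>2)"
    using sq by (intro integrableI_nonneg) (auto intro: le_less_trans)
  have "expectation est = v"
    using est0 est_nn v by (subst integral_eq_nn_integral) auto
  moreover have "expectation (\<lambda>\<omega>. (est \<omega>)\<^sup>2) \<le> v\<^sup>2 + v * (c + B)"
    using sq v c B by (subst integral_eq_nn_integral) (auto intro!: enn2real_leI)
  ultimately show "variance est \<le> v * (c + B)"
    using variance_eq[OF int int2] by simp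
qed

subsection \<open>The stochastic PPSWOR estimator\<close>

theorem theorem3p1:
  fixes M :: "'a measure" and X :: "'x set" and r :: "'x \<Rightarrow> nat"
    and S :: "'x \<Rightarrow> nat \<Rightarrow> 'a \<Rightarrow> real" and seed :: "'x \<Rightarrow> 'a \<Rightarrow> ereal"
    and T V :: real and v :: "'x \<Rightarrow> real" and k :: nat
  assumes "prob_space M"
    and "finite X"
    and "k \<ge> 3"
    and "T > 0"
    and indep: "prob_space.indep_vars M (\<lambda>_. borel) (\<lambda>(x, i). S x i) (SIGMA x:X. {1..r x})"
    and range: "\<And>x i \<omega>. x \<in> X \<Longrightarrow> i \<in> {1..r x} \<Longrightarrow> \<omega> \<in> space M \<Longrightarrow> S x i \<omega> \<in> {0..T}"
    and seeds: "ppswor_seeds M X (weight r S) seed"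
    and v: "\<And>x. x \<in> X \<Longrightarrow> v x = prob_space.expectation M (weight r S x)"
    and V: "V = (\<Sum>x\<in>X. v x)"
    and "V \<ge> T * real k"
    and "x \<in> X"
  shows "integrable M (inv_prob_estimator M k X seed (v x) x) \<and>
    integrable M (\<lambda>\<omega>. (inv_prob_estimator M k X seed (v x) x \<omega>)\<^sup>2) \<and>
    prob_space.variance M (inv_prob_estimator M k X seed (v x) x)
      \<le> 4 * v x * V / (real k - 2)"
proof -
  interpret prob_space M by fact
  have weight_nonneg: "0 \<le> weight r S y \<omega>" if "y \<in> X" "\<omega> \<in> space M" for y \<omega>
    unfolding weight_def using range[OF that(1) _ that(2)] by (intro sum_nonneg) auto
  have S_borel [measurable]: "S y i \<in> borel_measurable M" if "y \<in> X" "i \<in> {1..r y}" for y i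
    using indep that unfolding indep_vars_def by force
  have weight_int: "integrable M (weight r S y)" if "y \<in> X" for y
    unfolding weight_def using that range
    by (intro Bochner_Integration.integrable_sum integrable_const_bound[where B=T] AE_I2) auto
  have v_nonneg: "0 \<le> v y" if "y \<in> X" for y
    using v[OF that] weight_nonneg[OF that] by (simp add: Bochner_Integration.integral_nonneg_AE AE_I2)
  have "0 < T * real k" using \<open>T > 0\<close> \<open>k \<ge> 3\<close> by simp
  then have "V > 0" using \<open>V \<ge> T * real k\<close> by linarith
  show ?thesis
  \<comment> \<open>The lower bound on the inclusion probability is positive only for
    \<open>v x > 0\<close>.\<close>
  proof (cases "v x = 0")
    case True
    then have "inv_prob_estimator M k X seed (v x) x = (\<lambda>\<omega>. 0)"
      by (simp add: inv_prob_estimator_def fun_eq_iff)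
    then show ?thesis using True by simp
  next
    case False
    with v_nonneg \<open>x \<in> X\<close> have vx: "v x > 0" by force

    \<comment> \<open>Bounds on the inclusion probability\<close>
    let ?p = "\<lambda>z. prob {\<omega>\<in>space M. seed x \<omega> < z}"
    have p_mono: "?p z \<le> ?p z'" if "z \<le> z'" for z z'
      using that seeds \<open>x \<in> X\<close> by (intro finite_measure_mono) (auto simp: ppswor_seeds_def)
    have p_lower: "1 - exp (- v x * ((1 - exp (- T * t)) / T)) \<le> ?p (ereal t)" if "t > 0" for t
    proof -
      \<comment> \<open>The variables of \<open>x\<close> are indexed by pairs, so that they form a
        subfamily of the given independent family.\<close>
      let ?I = "Pair x ` {1..r x}" and ?Y = "\<lambda>(x, i). S x i"
      have weight_eq: "weight r S x = (\<lambda>\<omega>. \<Sum>p\<in>?I. ?Y p \<omega>)"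
        by (simp add: weight_def fun_eq_iff sum.reindex inj_on_def)
      have "expectation (\<lambda>\<omega>. exp (- weight r S x \<omega> * t)) \<le> exp (- v x * ((1 - exp (- T * t)) / T))"
        unfolding v[OF \<open>x \<in> X\<close>] weight_eq
      proof (rule expectation_exp_minus_sum_le)
        show "indep_vars (\<lambda>_. borel) ?Y ?I"
          using \<open>x \<in> X\<close> by (intro indep_vars_subset[OF indep]) auto
      qed (use range \<open>x \<in> X\<close> \<open>T > 0\<close> that in auto)
      then show ?thesis
        using prob_ppswor_seed_less[OF \<open>finite X\<close> seeds \<open>x \<in> X\<close> weight_nonneg[OF \<open>x \<in> X\<close>] that] by simp
    qed
    have p_real: "0 < ?p (ereal t) \<and> v x * (1 / ?p (ereal t) - 1) \<le> T + 1 / t" if "t > 0" for t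
    proof -
      define u where "u = (1 - exp (- T * t)) / T"
      have u: "u > 0" using that \<open>T > 0\<close> by (simp add: u_def)
      define q where "q = 1 - exp (- (v x * u))"
      have "0 < q" using mult_pos_pos[OF vx u] by (simp add: q_def)
      moreover have "q \<le> ?p (ereal t)" using p_lower[OF that] by (simp add: q_def u_def)
      ultimately have q: "0 < q" "q \<le> ?p (ereal t)" .
      have "1 / ?p (ereal t) \<le> 1 / q" using q by (intro divide_left_mono) auto
      also have "\<dots> \<le> 1 + 1 / (v x * u)"
        unfolding q_def using vx u by (intro inverse_one_minus_exp_le) simp
      \<comment> \<open>Here \<open>v x\<close> cancels, so the final bound depends on
        \<open>T\<close> and \<open>t\<close> alone.\<close>
      finally have "v x * (1 / ?p (ereal t) - 1) \<le> v x * (1 / (v x * u))"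
        using vx by (intro mult_left_mono) auto
      also have "\<dots> = T * (1 / (1 - exp (- (T * t))))" using vx by (simp add: u_def)
      also have "\<dots> \<le> T * (1 + 1 / (T * t))"
        using that \<open>T > 0\<close> by (intro mult_left_mono inverse_one_minus_exp_le) auto
      also have "\<dots> = T + 1 / t" using that \<open>T > 0\<close> by (simp add: field_simps)
      finally show ?thesis using q by auto
    qed
    have p_bound: "0 < ?p z \<and> v x * (1 / ?p z - 1) \<le> T + 1 / real_of_ereal z" if "z > 0" for z
    proof (cases z)
      case PInf
      have "0 < ?p \<infinity>" using p_real[of 1] p_mono[of "ereal 1" \<infinity>] by simp
      moreover have "v x * (1 / ?p \<infinity> - 1) \<le> T"
      \<comment> \<open>The bound at infinity is the limit of those at \<open>t = 1 / e\<close>; it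
        is \<open>T\<close>, in accordance with
        \<open>1 / real_of_ereal \<infinity> = 0\<close>.\<close>
      proof (rule field_le_epsilon)
        fix e :: real assume e: "e > 0"
        have "1 / ?p \<infinity> \<le> 1 / ?p (ereal (1 / e))"
          using p_real[of "1 / e"] p_mono[of "ereal (1 / e)" \<infinity>] e by (intro divide_left_mono) auto
        then have "v x * (1 / ?p \<infinity> - 1) \<le> v x * (1 / ?p (ereal (1 / e)) - 1)"
          using vx by (intro mult_left_mono) auto
        also have "\<dots> \<le> T + e" using p_real[of "1 / e"] e by simp
        finally show "v x * (1 / ?p \<infinity> - 1) \<le> T + e" .
      qed
      ultimately show ?thesis using PInf by simp
    qed (use that p_real in auto)

    \<comment> \<open>The estimator as a function of two independent variables\<close>
    define m where "m = k - 1"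
    have m: "2 \<le> m" "real m = real k - 1" using \<open>k \<ge> 3\<close> by (auto simp: m_def)
    define Z where "Z \<omega> = threshold m (X - {x}) (\<lambda>y. seed y \<omega>)" for \<omega>
    have est: "inv_prob_estimator M k X seed (v x) x
      = (\<lambda>\<omega>. if seed x \<omega> < \<infinity> \<and> seed x \<omega> \<le> Z \<omega> then v x / ?p (Z \<omega>) else 0)"
      using mem_bottom_sample_iff[OF \<open>finite X\<close> _ \<open>x \<in> X\<close>, of k]
        threshold_bottom_sample[OF \<open>finite X\<close>, of k x] \<open>k \<ge> 3\<close>
      by (simp add: fun_eq_iff inv_prob_estimator_def inclusion_prob_def Z_def m_def)

    have indW: "indep_vars (\<lambda>_. borel) (weight r S) X"
    proof -
      \<comment> \<open>Weights of different keys are functions of disjoint blocks of the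
        independent family.\<close>
      let ?K = "\<lambda>x. {x} \<times> {1..r x}"
      have "indep_vars (\<lambda>y. PiM (?K y) (\<lambda>_. borel)) (\<lambda>y \<omega>. restrict (\<lambda>j. (case j of (x, i) \<Rightarrow> S x i) \<omega>) (?K y)) X"
        by (rule indep_vars_restrict[OF indep]) (auto simp: disjoint_family_on_def)
      then have "indep_vars (\<lambda>_. borel) (\<lambda>y \<omega>. \<Sum>i\<in>{1..r y}.
          restrict (\<lambda>j. (case j of (x, i) \<Rightarrow> S x i) \<omega>) (?K y) (y, i)) X"
        by (rule indep_vars_compose2) simp
      then show ?thesis by (simp add: weight_def[abs_def])
    qed
    have ind_seeds: "indep_vars (\<lambda>_. borel) seed X"
      using \<open>finite X\<close> \<open>x \<in> X\<close> seeds indW by (intro indep_vars_ppswor_seeds) auto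
    have indep_Z: "indep_var borel (seed x) borel Z"
    proof -
      have "indep_var borel ((\<lambda>f. f x) \<circ> (\<lambda>\<omega>. restrict (\<lambda>y. seed y \<omega>) {x}))
          borel ((\<lambda>f. threshold m (X - {x}) f) \<circ> (\<lambda>\<omega>. restrict (\<lambda>y. seed y \<omega>) (X - {x})))"
      proof (rule indep_var_compose)
        show "indep_var (PiM {x} (\<lambda>_. borel)) (\<lambda>\<omega>. restrict (\<lambda>y. seed y \<omega>) {x})
            (PiM (X - {x}) (\<lambda>_. borel)) (\<lambda>\<omega>. restrict (\<lambda>y. seed y \<omega>) (X - {x}))"
          using \<open>x \<in> X\<close> by (intro indep_var_restrict[OF ind_seeds]) auto
        show "(\<lambda>f. threshold m (X - {x}) f) \<in> PiM (X - {x}) (\<lambda>_. borel) \<rightarrow>\<^sub>M borel"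
          using \<open>finite X\<close> m by (intro borel_measurable_threshold) auto
      qed simp
      then show ?thesis by (simp add: comp_def threshold_restrict Z_def[abs_def])
    qed
    then have Z_borel [measurable]: "Z \<in> borel_measurable M" by (rule indep_var_rv2)

    \<comment> \<open>Tail and reciprocal mean of \<open>Z\<close>, and the final constant\<close>
    define c where "c = V\<^sup>2 / (real m * (real m - 1))"
    have c: "c \<ge> 0" using m by (simp add: c_def)
    have Z_tail: "prob {\<omega>\<in>space M. Z \<omega> < ereal t} \<le> c * t\<^sup>2" if "t > 0" for t
    proof -
      have "prob {\<omega>\<in>space M. Z \<omega> < ereal t}
        \<le> (\<Sum>y\<in>X - {x}. prob {\<omega>\<in>space M. seed y \<omega> < ereal t})\<^sup>2 / (real m * (real m - 1))"
        unfolding Z_def using \<open>finite X\<close> m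
        by (intro prob_threshold_less_le indep_vars_subset[OF ind_seeds]) auto
      also have "\<dots> \<le> (V * t)\<^sup>2 / (real m * (real m - 1))"
      proof (intro divide_right_mono power_mono)
        have "(\<Sum>y\<in>X - {x}. prob {\<omega>\<in>space M. seed y \<omega> < ereal t}) \<le> (\<Sum>y\<in>X - {x}. v y * t)"
          using prob_ppswor_seed_less_le[OF \<open>finite X\<close> seeds] weight_nonneg weight_int v that
          by (intro sum_mono) auto
        also have "\<dots> \<le> (\<Sum>y\<in>X. v y * t)"
          using \<open>finite X\<close> v_nonneg that by (intro sum_mono2) auto
        finally show "(\<Sum>y\<in>X - {x}. prob {\<omega>\<in>space M. seed y \<omega> < ereal t}) \<le> V * t"
          by (simp add: V sum_distrib_right)
      qed (use m in \<open>auto intro: sum_nonneg\<close>)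
      finally show ?thesis by (simp add: c_def power_mult_distrib)
    qed
    have Z_pos: "AE \<omega> in M. Z \<omega> > 0"
    proof -
      have le: "prob {\<omega>\<in>space M. Z \<omega> \<le> 0} \<le> c * t\<^sup>2" if "t > 0" for t
      proof -
        have "prob {\<omega>\<in>space M. Z \<omega> \<le> 0} \<le> prob {\<omega>\<in>space M. Z \<omega> < ereal t}"
          using that by (intro finite_measure_mono) (auto intro: le_less_trans)
        with Z_tail[OF that] show ?thesis by simp
      qed
      \<comment> \<open>Letting \<open>t\<close> tend to 0 in the tail bound excludes nonpositive
        values of \<open>Z\<close>.\<close>
      have "((\<lambda>t. c * t\<^sup>2) \<longlongrightarrow> c * 0\<^sup>2) (at_right 0)" by (intro tendsto_intros)
      then have "prob {\<omega>\<in>space M. Z \<omega> \<le> 0} \<le> c * 0\<^sup>2"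
        by (rule tendsto_lowerbound) (auto simp: eventually_at_right_less le intro: eventually_mono[OF eventually_at_right_less])
      then have "emeasure M {\<omega>\<in>space M. Z \<omega> \<le> 0} = 0"
        by (simp add: emeasure_eq_measure measure_le_0_iff)
      then have "AE \<omega> in M. \<not> Z \<omega> \<le> 0" by (subst AE_iff_measurable) auto
      then show ?thesis by (simp add: not_le)
    qed
    \<comment> \<open>The minimum of \<open>1 / a + c * a\<close> lies at the inverse square root of
      \<open>c\<close>; this nearby choice avoids the root and gives
      \<open>1 / a = V / (real k - 2)\<close> and \<open>c * a = V / real m\<close>.\<close>
    define a where "a = (real m - 1) / V"
    have a: "a > 0" using m \<open>V > 0\<close> by (simp add: a_def)
    have EZ: "(\<integral>\<^sup>+\<omega>. ennreal (1 / real_of_ereal (Z \<omega>)) \<partial>M) \<le> ennreal (1 / a + c * a)"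
      by (rule nn_integral_inverse_le[OF Z_borel a c Z_tail])
    \<comment> \<open>Each of the three summands is at most \<open>V / (real k - 2)\<close>, so the
      constant 4 leaves one copy to spare.\<close>
    have "v x * (T + (1 / a + c * a)) \<le> 4 * v x * V / (real k - 2)"
    proof -
      have "T \<le> V / real k" using \<open>V \<ge> T * real k\<close> \<open>k \<ge> 3\<close> by (simp add: field_simps)
      also have "\<dots> \<le> V / (real k - 2)"
        using \<open>V > 0\<close> \<open>k \<ge> 3\<close> by (intro divide_left_mono) auto
      finally have T: "T \<le> V / (real k - 2)" .
      have "c * a = V / real m"
        using m \<open>V > 0\<close> by (simp add: c_def a_def power2_eq_square)
      also have "\<dots> \<le> V / (real k - 2)"
        using \<open>V > 0\<close> \<open>k \<ge> 3\<close> m by (intro divide_left_mono) auto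
      finally have "c * a \<le> V / (real k - 2)" .
      moreover have "1 / a = V / (real k - 2)" using m by (simp add: a_def)
      moreover have "0 \<le> V / (real k - 2)" using \<open>V > 0\<close> \<open>k \<ge> 3\<close> by simp
      ultimately have "T + (1 / a + c * a) \<le> 4 * (V / (real k - 2))" using T by linarith
      then have "v x * (T + (1 / a + c * a)) \<le> v x * (4 * (V / (real k - 2)))"
        using vx by (intro mult_left_mono) auto
      then show ?thesis by (simp add: ac_simps)
    qed
    moreover have "AE \<omega> in M. 0 < ?p (Z \<omega>)"
      and "AE \<omega> in M. v x * (1 / ?p (Z \<omega>) - 1) \<le> T + 1 / real_of_ereal (Z \<omega>)"
      using Z_pos p_bound by (auto elim!: eventually_mono)
    moreover have "0 \<le> 1 / a + c * a" using a c by simp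
    ultimately show ?thesis
      unfolding est
      using variance_inverse_probability[OF indep_Z prob_ppswor_seed_le[OF \<open>finite X\<close> seeds \<open>x \<in> X\<close>],
          of "v x" T "1 / a + c * a"] EZ vx \<open>T > 0\<close>
      by auto
  qed
qed

end
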